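(* Let the measure $\mu$ be supported on some segment $[\delta,b]$ with $0<\delta<b$. Then the Hausdorff operator $\mathbb{H}_{\Phi,\mu}$ is bounded on the Paley–Wiener space $PW$ if and only if $\Phi\in L^1(\mu)$.
   Context: $\mu$ is a regular positive Borel measure on $(0,\infty)$ and $\Phi:(0,\infty)\to\mathbb{C}$ is $\mu$-measurable. The Hausdorff operator is $$(\mathbb{H}_{\Phi,\mu}F)(z)=\int_0^\infty \Phi(u)\,F\left(\tfrac{z}{u}\right)d\mu(u),\quad z\in\mathbb{C}.$$ $PW=PW_\pi$ is the space of entire functions of exponential type (at most) $\pi$ whose restrictions to $\mathbb{R}$ belong to $L^2(\mathbb{R})$, with the $L^2(\mathbb{R})$ norm.
   Formalization: "Bounded on PW" is proved as bounded in L² norm from PW_π into the Paley–Wiener space of type max(π, π/δ), which is PW_π if δ ≥ 1; for δ < 1 the literal "if" fails (unit mass at 1/2, Φ = 1 gives F(2z)). *)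

theory Defs
  imports "HOL-Complex_Analysis.Complex_Analysis"
begin

definition regular_borel_measure_on :: "real set \<Rightarrow> real measure \<Rightarrow> bool" where
  "regular_borel_measure_on S M \<longleftrightarrow>
     sets M = sets (restrict_space borel S) \<and>
     (\<forall>K. compact K \<and> K \<subseteq> S \<longrightarrow> emeasure M K < \<infinity>) \<and>
     (\<forall>A\<in>sets M. emeasure M A = (INF U\<in>{U. openin (top_of_set S) U \<and> A \<subseteq> U}. emeasure M U)) \<and>
     (\<forall>A\<in>sets M. emeasure M A = (SUP K\<in>{K. compact K \<and> K \<subseteq> A}. emeasure M K))"

definition supported_on :: "real measure \<Rightarrow> real set \<Rightarrow> bool" where
  "supported_on M A \<longleftrightarrow> space M - A \<in> null_sets M"

definition exponential_type_le :: "(complex \<Rightarrow> complex) \<Rightarrow> real \<Rightarrow> bool" where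
  "exponential_type_le F \<sigma> \<longleftrightarrow>
     (\<forall>\<epsilon>>0. \<exists>A. \<forall>z. cmod (F z) \<le> A * exp ((\<sigma> + \<epsilon>) * cmod z))"

definition PW :: "real \<Rightarrow> (complex \<Rightarrow> complex) set" where
  "PW \<sigma> = {F. F holomorphic_on UNIV \<and> exponential_type_le F \<sigma> \<and>
              integrable lborel (\<lambda>x::real. (cmod (F (complex_of_real x)))\<^sup>2)}"

definition PW_norm :: "(complex \<Rightarrow> complex) \<Rightarrow> real" where
  "PW_norm F = sqrt (LINT x|lborel. (cmod (F (complex_of_real x)))\<^sup>2)"

text \<open>Measurability and integration with respect to a Borel measure refer to its completion, so
  that \<open>\<Phi>\<close> need only be measurable up to null sets.\<close>

definition hausdorff_op ::
  "(real \<Rightarrow> complex) \<Rightarrow> real measure \<Rightarrow> (complex \<Rightarrow> complex) \<Rightarrow> complex \<Rightarrow> complex" where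
  "hausdorff_op \<Phi> \<mu> F z = (LINT u|completion \<mu>. \<Phi> u * F (z / complex_of_real u))"

text \<open>The Bochner integral is \<open>0\<close> for non-integrable functions, so the first conjunct, the
  existence of the defining integral, has to be stated separately.\<close>

definition hausdorff_bounded ::
  "(real \<Rightarrow> complex) \<Rightarrow> real measure \<Rightarrow> (complex \<Rightarrow> complex) set \<Rightarrow> (complex \<Rightarrow> complex) set \<Rightarrow> bool"
  where
  "hausdorff_bounded \<Phi> \<mu> X Y \<longleftrightarrow>
     (\<forall>F\<in>X. \<forall>z. integrable (completion \<mu>) (\<lambda>u. \<Phi> u * F (z / complex_of_real u))) \<and>
     (\<forall>F\<in>X. hausdorff_op \<Phi> \<mu> F \<in> Y) \<and>
     (\<exists>C. \<forall>F\<in>X. PW_norm (hausdorff_op \<Phi> \<mu> F) \<le> C * PW_norm F)"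

text \<open>The dilation \<open>F (z / u)\<close> of a function of type \<open>pi\<close> has type \<open>pi / u\<close>. For a measure on
  \<open>{\<delta>..b}\<close> the values of the operator on \<open>PW pi\<close> therefore lie in \<open>PW (max pi (pi / \<delta>))\<close>. This is
  \<open>PW pi\<close> itself if \<open>\<delta> \<ge> 1\<close>. If \<open>\<delta> < 1\<close> the operator need not map \<open>PW pi\<close> to itself even for
  integrable \<open>\<Phi>\<close>: for the unit mass at \<open>1/2\<close> and \<open>\<Phi> = 1\<close> it is \<open>F (2 * z)\<close>. The norm is the norm of
  \<open>L\<^sup>2(\<real>)\<close> for every type.\<close>

end

theory Submission imports Defs "HOL-Probability.Sinc_Integral" begin

text \<open>Both directions are elementary once one looks at the right point.

  If the operator is defined on \<open>PW pi\<close>, then \<open>\<Phi>\<close> is integrable because of the value at the origin: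
  all dilations of \<open>F\<close> agree there, so the defining integral at \<open>z = 0\<close> is that of \<open>\<Phi> u * F 0\<close>, and
  some \<open>F\<close> in \<open>PW pi\<close>, a multiple of the cardinal sine, has \<open>F 0 \<noteq> 0\<close> (\<open>sinc_pi_in_PW\<close>).

  Conversely let \<open>\<Phi>\<close> be integrable. Almost every \<open>u\<close> lies in \<open>{\<delta>..b}\<close>, so \<open>z / u\<close> stays in the disc
  of radius \<open>cmod z / \<delta>\<close>, on which \<open>F\<close> is bounded. Hence the integral exists, and it inherits from
  \<open>F\<close> that it is entire (integrate the Taylor series term by term, \<open>holomorphic_transform\<close>) and of
  exponential type, now divided by \<open>\<delta>\<close> (\<open>exponential_type_transform\<close>). The bound in \<open>L\<^sup>2\<close> is
  a form of Minkowski's integral inequality: by Cauchy--Schwarz for the measure of density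
  \<open>cmod \<Phi>\<close>, the square of the transform at \<open>x\<close> is at most the \<open>L\<^sup>1\<close> norm of \<open>\<Phi>\<close> times the integral
  of \<open>cmod (\<Phi> u) * (cmod (F (x / u)))\<^sup>2\<close> over \<open>u\<close>. Integrating over \<open>x\<close>, exchanging the integrals and
  substituting \<open>x = u * y\<close> produces a factor \<open>u \<le> b\<close>; so the operator norm is at most \<open>sqrt b\<close> times
  the \<open>L\<^sup>1\<close> norm of \<open>\<Phi>\<close> (\<open>square_integral_transform_le\<close>).\<close>


section \<open>A function of type \<open>pi\<close> that does not vanish at the origin\<close>

lemma holomorphic_sinc_pi:
  "(\<lambda>z::complex. if z = 0 then of_real pi else sin (of_real pi * z) / z) holomorphic_on UNIV"
proof (rule pole_theorem_open_0[where a = 0])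
  show "(\<lambda>z::complex. sin (of_real pi * z)) holomorphic_on UNIV"
    by (intro holomorphic_intros)
  have "((\<lambda>z::complex. sin (of_real pi * z)) has_field_derivative of_real pi) (at 0)"
    by (auto intro!: derivative_eq_intros)
  then show "(if (0::complex) = 0 then of_real pi else sin (of_real pi * 0) / 0)
      = deriv (\<lambda>z::complex. sin (of_real pi * z)) 0"
    by (simp add: DERIV_imp_deriv)
qed auto

lemma exponential_type_sinc_pi:
  "exponential_type_le (\<lambda>z. if z = 0 then of_real pi else sin (of_real pi * z) / z) pi"
proof -
  let ?F = "\<lambda>z::complex. if z = 0 then of_real pi else sin (of_real pi * z) / z"
  have "compact (?F ` cball 0 1)"
    by (intro compact_continuous_image holomorphic_on_imp_continuous_on
          holomorphic_on_subset[OF holomorphic_sinc_pi]) auto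
  then obtain B where B: "\<And>z. cmod z \<le> 1 \<Longrightarrow> cmod (?F z) \<le> B"
    by (fastforce dest!: compact_imp_bounded simp: bounded_iff)
  have "cmod (?F z) \<le> max B 1 * exp ((pi + \<epsilon>) * cmod z)" if "\<epsilon> > 0" for z \<epsilon>
  proof (cases "cmod z \<le> 1")
    case True
    have "1 \<le> exp ((pi + \<epsilon>) * cmod z)"
      using that pi_gt_zero by (intro one_le_exp_iff[THEN iffD2] mult_nonneg_nonneg) auto
    then have "max B 1 * 1 \<le> max B 1 * exp ((pi + \<epsilon>) * cmod z)"
      by (intro mult_left_mono) auto
    with B[OF True] show ?thesis by linarith
  next
    case False
    have "cmod (sin (of_real pi * z)) \<le> exp \<bar>Im (of_real pi * z)\<bar>"
      using cmod_sin_le_exp[of 1 "of_real pi * z"] by simp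
    also have "\<dots> \<le> exp ((pi + \<epsilon>) * cmod z)"
      using abs_Im_le_cmod[of z] that pi_gt_zero by (auto simp: abs_mult intro!: mult_mono)
    finally have *: "cmod (sin (of_real pi * z)) \<le> exp ((pi + \<epsilon>) * cmod z)" .
    have "cmod (?F z) = cmod (sin (of_real pi * z)) / cmod z"
      using False by (auto simp: norm_divide)
    also have "\<dots> \<le> cmod (sin (of_real pi * z)) / 1"
      using False by (intro divide_left_mono) auto
    also have "\<dots> \<le> 1 * exp ((pi + \<epsilon>) * cmod z)" using * by simp
    also have "\<dots> \<le> max B 1 * exp ((pi + \<epsilon>) * cmod z)"
      by (intro mult_right_mono) auto
    finally show ?thesis .
  qed
  then show ?thesis unfolding exponential_type_le_def by blast
qed

lemma square_sinc_pi_le: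
  fixes x :: real
  assumes "x \<noteq> 0"
  shows "(sin (pi * x) / x)\<^sup>2 \<le> (1 + pi\<^sup>2) * inverse (1 + x\<^sup>2)"
proof -
  have "\<bar>sin (pi * x)\<bar> \<le> \<bar>pi * x\<bar>" by (rule abs_sin_x_le_abs_x)
  then have 1: "(sin (pi * x))\<^sup>2 \<le> pi\<^sup>2 * x\<^sup>2" by (metis abs_le_square_iff power_mult_distrib)
  have 2: "(sin (pi * x))\<^sup>2 \<le> 1" by (simp add: abs_square_le_1)
  have "(sin (pi * x))\<^sup>2 * (1 + x\<^sup>2) = (sin (pi * x))\<^sup>2 + (sin (pi * x))\<^sup>2 * x\<^sup>2"
    by (simp add: algebra_simps)
  also have "\<dots> \<le> pi\<^sup>2 * x\<^sup>2 + 1 * x\<^sup>2"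
    using 1 2 by (intro add_mono mult_right_mono) auto
  finally have "(sin (pi * x))\<^sup>2 * (1 + x\<^sup>2) \<le> (1 + pi\<^sup>2) * x\<^sup>2" by (simp add: algebra_simps)
  moreover have pos: "1 + x\<^sup>2 > 0" "x\<^sup>2 > 0" using assms by (auto simp: add_pos_nonneg)
  ultimately have "(sin (pi * x))\<^sup>2 / x\<^sup>2 \<le> (1 + pi\<^sup>2) / (1 + x\<^sup>2)"
    by (simp only: pos_divide_le_eq[OF pos(2)] times_divide_eq_left pos_le_divide_eq[OF pos(1)])
  then show ?thesis by (simp only: power_divide flip: divide_inverse)
qed

lemma sinc_pi_in_PW:
  "(\<lambda>z. if z = 0 then of_real pi else sin (of_real pi * z) / z) \<in> PW pi" (is "?F \<in> _")
proof -
  have meas: "?F \<in> borel_measurable borel"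
    by (intro borel_measurable_continuous_onI holomorphic_on_imp_continuous_on holomorphic_sinc_pi)
  have majorant: "integrable lborel (\<lambda>x::real. (1 + pi\<^sup>2) * inverse (1 + x\<^sup>2))"
    using integrable_inverse_1_plus_square by (simp add: set_integrable_def einterval_eq)
  have meas_real: "(\<lambda>x::real. (cmod (?F (of_real x)))\<^sup>2) \<in> borel_measurable lborel"
    by (intro borel_measurable_power borel_measurable_norm
          measurable_compose[OF _ meas, of complex_of_real]) measurable
  have le: "(cmod (?F (of_real x)))\<^sup>2 \<le> (1 + pi\<^sup>2) * inverse (1 + x\<^sup>2)" for x :: real
  proof (cases "x = 0")
    case False
    have "?F (of_real x) = of_real (sin (pi * x) / x)"
      using False by (simp add: sin_of_real flip: of_real_mult)
    then have "(cmod (?F (of_real x)))\<^sup>2 = (sin (pi * x) / x)\<^sup>2"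
      by (simp only: norm_of_real power2_abs)
    then show ?thesis using square_sinc_pi_le[OF False] by simp
  qed simp
  have "integrable lborel (\<lambda>x::real. (cmod (?F (of_real x)))\<^sup>2)"
    by (rule Bochner_Integration.integrable_bound[OF majorant meas_real], intro AE_I2)
      (simp only: real_norm_def abs_power2 order_trans[OF le abs_ge_self])
  then show ?thesis
    unfolding PW_def using holomorphic_sinc_pi exponential_type_sinc_pi by simp
qed


section \<open>The weighted Cauchy--Schwarz inequality\<close>

text \<open>The variance of \<open>cmod \<circ> g\<close> under the measure of density \<open>cmod \<circ> f\<close> is nonnegative. In the form
  multiplied out by the total mass \<open>W\<close> this costs no normalisation; only \<open>W = 0\<close> is separate.\<close>

lemma norm_integral_mult_square_le:
  fixes f g :: "'a \<Rightarrow> complex"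
  assumes f: "integrable M f" and g [measurable]: "g \<in> borel_measurable M"
    and bdd: "AE u in M. cmod (g u) \<le> B"
  shows "integrable M (\<lambda>u. f u * g u)" (is ?A)
    and "integrable M (\<lambda>u. cmod (f u) * (cmod (g u))\<^sup>2)" (is ?B)
    and "(cmod (LINT u|M. f u * g u))\<^sup>2
           \<le> (LINT u|M. cmod (f u)) * (LINT u|M. cmod (f u) * (cmod (g u))\<^sup>2)" (is ?C)
proof -
  have [measurable]: "f \<in> borel_measurable M" using f by auto
  have nf: "integrable M (\<lambda>u. cmod (f u))" using f by simp
  show A: ?A
  proof (rule Bochner_Integration.integrable_bound)
    show "integrable M (\<lambda>u. f u * of_real B)" using f by simp
    show "AE u in M. norm (f u * g u) \<le> norm (f u * of_real B)"
      using bdd by eventually_elim (auto simp: norm_mult intro!: mult_left_mono)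
  qed simp
  show B: ?B
  proof (rule Bochner_Integration.integrable_bound)
    show "integrable M (\<lambda>u. cmod (f u) * B\<^sup>2)" using nf by simp
    show "AE u in M. norm (cmod (f u) * (cmod (g u))\<^sup>2) \<le> norm (cmod (f u) * B\<^sup>2)"
      using bdd by eventually_elim (auto simp: abs_mult intro!: mult_left_mono power_mono)
  qed simp
  have nfg: "integrable M (\<lambda>u. cmod (f u) * cmod (g u))"
    using integrable_norm[OF A] by (simp add: norm_mult)
  define W I m where "W = (LINT u|M. cmod (f u))"
    and "I = (LINT u|M. cmod (f u) * (cmod (g u))\<^sup>2)"
    and "m = (LINT u|M. cmod (f u) * cmod (g u))"
  have "cmod (LINT u|M. f u * g u) \<le> m"
    using integral_norm_bound[of M "\<lambda>u. f u * g u"] by (simp add: m_def norm_mult)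
  then have le_m: "(cmod (LINT u|M. f u * g u))\<^sup>2 \<le> m\<^sup>2" by (intro power_mono) auto
  have "W \<ge> 0" unfolding W_def by simp
  have "m\<^sup>2 \<le> W * I"
  proof (cases "W = 0")
    case True
    then have "AE u in M. cmod (f u) = 0"
      using integral_nonneg_eq_0_iff_AE[OF nf] by (simp add: W_def)
    then have "m = (LINT u|M. 0)"
      unfolding m_def by (intro integral_cong_AE) auto
    then show ?thesis using True by simp
  next
    case False
    have "0 \<le> (LINT u|M. cmod (f u) * (W * cmod (g u) - m)\<^sup>2)" by simp
    also have "\<dots> = (LINT u|M. W\<^sup>2 * (cmod (f u) * (cmod (g u))\<^sup>2)
        - 2 * W * m * (cmod (f u) * cmod (g u)) + m\<^sup>2 * cmod (f u))"
      by (intro Bochner_Integration.integral_cong) (auto simp: power2_eq_square algebra_simps)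
    also have "\<dots> = W\<^sup>2 * I - 2 * W * m * m + m\<^sup>2 * W"
      using B nfg nf by (simp add: W_def I_def m_def)
    also have "\<dots> = W * (W * I - m\<^sup>2)" by (simp add: power2_eq_square algebra_simps)
    finally show ?thesis
      using False \<open>W \<ge> 0\<close> by (simp add: zero_le_mult_iff)
  qed
  with le_m show ?C unfolding W_def I_def by linarith
qed


section \<open>Integrated dilations of an entire function\<close>

lemma entire_borel_measurable:
  "F holomorphic_on UNIV \<Longrightarrow> F \<in> borel_measurable borel"
  for F :: "complex \<Rightarrow> complex"
  by (intro borel_measurable_continuous_onI holomorphic_on_imp_continuous_on)

text \<open>The Hausdorff operator with an integrable kernel. The measure \<open>M\<close> may be larger than a Borel
  measure, such as a completion, so it enters only through measurability of the identity.\<close>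

locale integrable_hausdorff_kernel = finite_measure M
  for M :: "real measure" +
  fixes \<Phi> :: "real \<Rightarrow> complex" and \<delta> b :: real
  assumes ident_measurable [measurable]: "(\<lambda>u. u) \<in> borel_measurable M"
    and integrable_kernel: "integrable M \<Phi>"
    and AE_support: "AE u in M. \<delta> \<le> u \<and> u \<le> b"
    and \<delta>_pos: "0 < \<delta>"
begin

definition transform :: "(complex \<Rightarrow> complex) \<Rightarrow> complex \<Rightarrow> complex" where
  "transform F z = (LINT u|M. \<Phi> u * F (z / of_real u))"

definition mass :: real where
  "mass = (LINT u|M. cmod (\<Phi> u))"

lemma kernel_measurable [measurable]: "\<Phi> \<in> borel_measurable M"
  using integrable_kernel by auto

lemma mass_nonneg: "0 \<le> mass"
  by (simp add: mass_def)

lemma AE_dilation_norm_le: "AE u in M. cmod (z / of_real u) \<le> cmod z / \<delta>"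
  using AE_support
  by eventually_elim (use \<delta>_pos in \<open>auto simp: norm_divide intro!: divide_left_mono\<close>)

context
  fixes F :: "complex \<Rightarrow> complex"
  assumes entire: "F holomorphic_on UNIV"
begin

lemma F_measurable [measurable]: "F \<in> borel_measurable borel"
  using entire by (rule entire_borel_measurable)

lemma dilation_measurable: "(\<lambda>u. F (z / of_real u)) \<in> borel_measurable M"
  by measurable

lemma AE_dilation_bounded: "\<exists>B. AE u in M. cmod (F (z / of_real u)) \<le> B"
proof -
  have "compact (F ` cball 0 (cmod z / \<delta>))"
    by (intro compact_continuous_image holomorphic_on_imp_continuous_on
          holomorphic_on_subset[OF entire]) auto
  then obtain B where "\<And>w. cmod w \<le> cmod z / \<delta> \<Longrightarrow> cmod (F w) \<le> B"
    by (fastforce dest!: compact_imp_bounded simp: bounded_iff)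
  then have "AE u in M. cmod (F (z / of_real u)) \<le> B"
    using AE_dilation_norm_le[of z] by (auto elim!: eventually_mono)
  then show ?thesis by blast
qed

lemma integrable_transform: "integrable M (\<lambda>u. \<Phi> u * F (z / of_real u))"
  using AE_dilation_bounded[of z] norm_integral_mult_square_le(1)[OF integrable_kernel dilation_measurable]
  by blast

text \<open>Taylor's series of \<open>F\<close> converges absolutely at \<open>cmod z / \<delta>\<close>, which dominates the series at
  \<open>z / u\<close> uniformly in \<open>u\<close>. So it may be integrated term by term, and the moments of \<open>\<Phi>\<close> against
  the powers of \<open>1 / u\<close> give a power series that converges in the whole plane.\<close>

lemma holomorphic_transform: "transform F holomorphic_on UNIV"
proof -
  define a where "a n = (deriv ^^ n) F 0 / fact n" for n
  define c where "c n = (LINT u|M. \<Phi> u * (a n * (1 / of_real u) ^ n))" for n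
  have taylor: "(\<lambda>n. a n * w ^ n) sums F w" for w
    using holomorphic_power_series[of F 0 "cmod w + 1" w] holomorphic_on_subset[OF entire]
    by (simp add: a_def)
  have abs_conv: "summable (\<lambda>n. cmod (a n * w ^ n))" for w
    by (rule powser_insidea[of _ "of_real (cmod w + 1)"])
      (use taylor sums_summable in \<open>auto simp: abs_of_nonneg simp del: of_real_add\<close>)
  have "(\<lambda>n. c n * z ^ n) sums transform F z" for z
  proof -
    let ?f = "\<lambda>n u. \<Phi> u * (a n * (z / complex_of_real u) ^ n)"
    let ?r = "complex_of_real (cmod z / \<delta>)"
    have r: "cmod ?r = cmod z / \<delta>" using \<delta>_pos by (simp add: norm_divide)
    have dom: "AE u in M. cmod (?f n u) \<le> cmod (\<Phi> u) * cmod (a n * ?r ^ n)" for n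
      using AE_dilation_norm_le[of z]
    proof eventually_elim
      case (elim u)
      have "cmod (z / complex_of_real u) ^ n \<le> cmod ?r ^ n"
        using elim by (simp only: r power_mono norm_ge_zero)
      then show ?case
        by (auto simp only: norm_mult norm_power intro!: mult_left_mono norm_ge_zero)
    qed
    have int_dom: "integrable M (\<lambda>u. cmod (\<Phi> u) * cmod (a n * ?r ^ n))" for n
      using integrable_kernel by simp
    have int: "integrable M (?f n)" for n
      by (rule Bochner_Integration.integrable_bound[OF int_dom]) (use dom[of n] in auto)
    have "(LINT u|M. cmod (?f n u)) \<le> mass * cmod (a n * ?r ^ n)" for n
    proof -
      have "(LINT u|M. cmod (?f n u)) \<le> (LINT u|M. cmod (\<Phi> u) * cmod (a n * ?r ^ n))"
        by (intro integral_mono_AE integrable_norm int int_dom dom)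
      then show ?thesis by (simp add: mass_def)
    qed
    then have "summable (\<lambda>n. LINT u|M. cmod (?f n u))"
      by (intro summable_comparison_test'[OF summable_mult[OF abs_conv[of ?r]], of 0]) auto
    moreover have "summable (\<lambda>n. cmod (?f n u))" for u
      using summable_mult[OF abs_conv[of "z / complex_of_real u"], of "cmod (\<Phi> u)"]
      by (simp only: norm_mult mult.assoc)
    ultimately have "(\<lambda>n. LINT u|M. ?f n u) sums (LINT u|M. (\<Sum>n. ?f n u))"
      by (intro sums_integral int AE_I2)
    moreover have "(\<Sum>n. ?f n u) = \<Phi> u * F (z / of_real u)" for u
      by (intro sums_unique[symmetric] sums_mult taylor)
    moreover have "(LINT u|M. ?f n u) = c n * z ^ n" for n
    proof -
      have "(LINT u|M. ?f n u) = (LINT u|M. \<Phi> u * (a n * (1 / of_real u) ^ n) * z ^ n)"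
        by (intro Bochner_Integration.integral_cong) (auto simp: power_divide)
      then show ?thesis by (simp add: c_def)
    qed
    ultimately show ?thesis by (simp add: transform_def)
  qed
  then have "transform F holomorphic_on ball 0 r" for r
    by (intro power_series_holomorphic[of _ _ c]) auto
  then have "transform F field_differentiable at z" for z
    by (metis holomorphic_on_imp_differentiable_at open_ball centre_in_ball mem_ball_0
        less_add_one)
  then show ?thesis by (simp add: holomorphic_on_def)
qed

text \<open>The error \<open>\<epsilon>\<close> allowed for the transform is spent as \<open>\<epsilon> * \<delta>\<close> on \<open>F\<close>, because the dilation
  divides it by \<open>\<delta>\<close> again.\<close>

lemma exponential_type_transform:
  assumes type: "exponential_type_le F \<sigma>" and "0 \<le> \<sigma>"
  shows "exponential_type_le (transform F) (\<sigma> / \<delta>)"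
  unfolding exponential_type_le_def
proof (intro allI impI)
  fix \<epsilon> :: real assume "\<epsilon> > 0"
  then have pos: "0 < \<epsilon> * \<delta>" using \<delta>_pos by simp
  then obtain A where A: "\<And>z. cmod (F z) \<le> A * exp ((\<sigma> + \<epsilon> * \<delta>) * cmod z)"
    using type unfolding exponential_type_le_def by blast
  have "0 \<le> A" using A[of 0] norm_ge_zero[of "F 0"] by (simp del: norm_ge_zero)
  have "cmod (transform F z) \<le> mass * A * exp ((\<sigma> / \<delta> + \<epsilon>) * cmod z)" for z
  proof -
    let ?E = "A * exp ((\<sigma> / \<delta> + \<epsilon>) * cmod z)"
    have "AE u in M. cmod (\<Phi> u * F (z / of_real u)) \<le> cmod (\<Phi> u) * ?E"
      using AE_dilation_norm_le[of z]
    proof eventually_elim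
      case (elim u)
      have "(\<sigma> + \<epsilon> * \<delta>) * cmod (z / of_real u) \<le> (\<sigma> + \<epsilon> * \<delta>) * (cmod z / \<delta>)"
        using elim \<open>0 \<le> \<sigma>\<close> pos by (intro mult_left_mono) auto
      also have "\<dots> = (\<sigma> / \<delta> + \<epsilon>) * cmod z"
        using \<delta>_pos by (simp add: field_simps)
      finally have "cmod (F (z / of_real u)) \<le> ?E"
        using A[of "z / of_real u"] \<open>0 \<le> A\<close> by (meson order_trans mult_left_mono exp_le_cancel_iff)
      then show ?case by (simp only: norm_mult mult_left_mono norm_ge_zero)
    qed
    then have "(LINT u|M. cmod (\<Phi> u * F (z / of_real u))) \<le> (LINT u|M. cmod (\<Phi> u) * ?E)"
      using integrable_kernel by (intro integral_mono_AE integrable_norm integrable_transform) auto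
    then have "cmod (transform F z) \<le> (LINT u|M. cmod (\<Phi> u) * ?E)"
      unfolding transform_def by (rule order_trans[OF integral_norm_bound])
    then show ?thesis by (simp add: mass_def mult.assoc)
  qed
  then show "\<exists>A. \<forall>z. cmod (transform F z) \<le> A * exp ((\<sigma> / \<delta> + \<epsilon>) * cmod z)" by blast
qed

lemma transform_measurable: "(\<lambda>x. transform F (complex_of_real x)) \<in> borel_measurable lborel"
proof -
  have "complex_of_real \<in> borel_measurable lborel"
    unfolding measurable_lborel2 by (intro borel_measurable_continuous_onI continuous_intros)
  moreover have "transform F \<in> borel_measurable borel"
    by (intro entire_borel_measurable holomorphic_transform)
  ultimately show ?thesis by (rule measurable_compose)
qed

lemma nn_integral_dilation:
  assumes "u > 0"
  shows "(\<integral>\<^sup>+x. ennreal ((cmod (F (of_real x / of_real u)))\<^sup>2) \<partial>lborel)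
       = ennreal u * (\<integral>\<^sup>+x. ennreal ((cmod (F (of_real x)))\<^sup>2) \<partial>lborel)"
  using nn_integral_real_affine[of "\<lambda>x. ennreal ((cmod (F (of_real x / of_real u)))\<^sup>2)" u 0] assms
  by simp

lemma square_integral_transform_le:
  "(\<integral>\<^sup>+x. ennreal ((cmod (transform F (of_real x)))\<^sup>2) \<partial>lborel)
     \<le> ennreal (mass\<^sup>2 * b) * (\<integral>\<^sup>+x. ennreal ((cmod (F (of_real x)))\<^sup>2) \<partial>lborel)"
proof -
  interpret pair: pair_sigma_finite lborel M ..
  let ?N = "\<integral>\<^sup>+x. ennreal ((cmod (F (of_real x)))\<^sup>2) \<partial>lborel"
  let ?k = "\<lambda>x u. ennreal (cmod (\<Phi> u)) * ennreal ((cmod (F (of_real x / of_real u)))\<^sup>2)"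
  have pointwise: "ennreal ((cmod (transform F (of_real x)))\<^sup>2) \<le> ennreal mass * (\<integral>\<^sup>+u. ?k x u \<partial>M)" for x
  proof -
    obtain B where B: "AE u in M. cmod (F (of_real x / of_real u)) \<le> B"
      using AE_dilation_bounded by blast
    note cs = norm_integral_mult_square_le[OF integrable_kernel dilation_measurable B]
    have "(\<integral>\<^sup>+u. ?k x u \<partial>M)
        = ennreal (LINT u|M. cmod (\<Phi> u) * (cmod (F (of_real x / of_real u)))\<^sup>2)"
      using nn_integral_eq_integral[OF cs(2)] by (simp add: ennreal_mult)
    then have "ennreal mass * (\<integral>\<^sup>+u. ?k x u \<partial>M)
        = ennreal (mass * (LINT u|M. cmod (\<Phi> u) * (cmod (F (of_real x / of_real u)))\<^sup>2))"
      using mass_nonneg by (simp add: ennreal_mult)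
    then show ?thesis
      using cs(3) by (simp add: transform_def mass_def ennreal_leI)
  qed
  have "(\<integral>\<^sup>+x. ennreal ((cmod (transform F (of_real x)))\<^sup>2) \<partial>lborel)
      \<le> (\<integral>\<^sup>+x. ennreal mass * (\<integral>\<^sup>+u. ?k x u \<partial>M) \<partial>lborel)"
    by (intro nn_integral_mono pointwise)
  also have "\<dots> = ennreal mass * (\<integral>\<^sup>+x. (\<integral>\<^sup>+u. ?k x u \<partial>M) \<partial>lborel)"
    by (intro nn_integral_cmult) measurable
  also have "(\<integral>\<^sup>+x. (\<integral>\<^sup>+u. ?k x u \<partial>M) \<partial>lborel) = (\<integral>\<^sup>+u. (\<integral>\<^sup>+x. ?k x u \<partial>lborel) \<partial>M)"
    by (intro pair.Fubini'[symmetric]) measurable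
  also have "\<dots> \<le> (\<integral>\<^sup>+u. ennreal (cmod (\<Phi> u)) * (ennreal b * ?N) \<partial>M)"
  proof (intro nn_integral_mono_AE)
    show "AE u in M. (\<integral>\<^sup>+x. ?k x u \<partial>lborel) \<le> ennreal (cmod (\<Phi> u)) * (ennreal b * ?N)"
      using AE_support
    proof eventually_elim
      case (elim u)
      then have "u > 0" using \<delta>_pos by linarith
      have "(\<integral>\<^sup>+x. ?k x u \<partial>lborel) = ennreal (cmod (\<Phi> u)) * (ennreal u * ?N)"
        by (subst nn_integral_cmult) (auto simp: nn_integral_dilation[OF \<open>u > 0\<close>])
      also have "\<dots> \<le> ennreal (cmod (\<Phi> u)) * (ennreal b * ?N)"
        using elim by (intro mult_left_mono mult_right_mono ennreal_leI) auto
      finally show ?case .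
    qed
  qed
  also have "\<dots> = ennreal mass * (ennreal b * ?N)"
    using nn_integral_eq_integral[OF integrable_norm[OF integrable_kernel]]
    by (subst nn_integral_multc) (auto simp: mass_def)
  also have "ennreal mass * (ennreal mass * (ennreal b * ?N)) = ennreal (mass\<^sup>2 * b) * ?N"
    using mass_nonneg by (simp add: ennreal_mult' power2_eq_square mult.assoc)
  finally show ?thesis by (simp add: mult_left_mono)
qed

lemma PW_norm_transform_le:
  assumes L2: "integrable lborel (\<lambda>x::real. (cmod (F (of_real x)))\<^sup>2)" and "0 \<le> b"
  shows "integrable lborel (\<lambda>x::real. (cmod (transform F (of_real x)))\<^sup>2)"
    and "PW_norm (transform F) \<le> mass * sqrt b * PW_norm F"
proof -
  let ?f = "\<lambda>x::real. (cmod (F (of_real x)))\<^sup>2"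
  let ?g = "\<lambda>x::real. (cmod (transform F (of_real x)))\<^sup>2"
  have [measurable]: "?g \<in> borel_measurable lborel"
    using transform_measurable by measurable
  have le: "(\<integral>\<^sup>+x. ennreal (?g x) \<partial>lborel) \<le> ennreal (mass\<^sup>2 * b * (LINT x|lborel. ?f x))"
    using square_integral_transform_le \<open>0 \<le> b\<close> nn_integral_eq_integral[OF L2]
    by (simp add: ennreal_mult')
  show int: "integrable lborel ?g"
    by (rule integrableI_bounded) (use le in \<open>auto simp: le_less_trans\<close>)
  then have "(LINT x|lborel. ?g x) \<le> mass\<^sup>2 * b * (LINT x|lborel. ?f x)"
    using le nn_integral_eq_integral[OF int] \<open>0 \<le> b\<close> by (simp add: ennreal_le_iff)
  then have "PW_norm (transform F) \<le> sqrt (mass\<^sup>2 * b * (LINT x|lborel. ?f x))"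
    by (simp add: PW_norm_def)
  also have "\<dots> = mass * sqrt b * PW_norm F"
    using mass_nonneg by (simp add: PW_norm_def real_sqrt_mult)
  finally show "PW_norm (transform F) \<le> mass * sqrt b * PW_norm F" .
qed

end

end

lemma exponential_type_le_mono:
  assumes F: "exponential_type_le F \<sigma>" and "\<sigma> \<le> \<tau>"
  shows "exponential_type_le F \<tau>"
  unfolding exponential_type_le_def
proof (intro allI impI)
  fix \<epsilon> :: real assume "\<epsilon> > 0"
  then obtain A where A: "\<And>z. cmod (F z) \<le> A * exp ((\<sigma> + \<epsilon>) * cmod z)"
    using F unfolding exponential_type_le_def by blast
  have "0 \<le> A" using A[of 0] norm_ge_zero[of "F 0"] by (simp del: norm_ge_zero)
  have "A * exp ((\<sigma> + \<epsilon>) * cmod z) \<le> A * exp ((\<tau> + \<epsilon>) * cmod z)" for z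
    using \<open>0 \<le> A\<close> \<open>\<sigma> \<le> \<tau>\<close> by (auto intro!: mult_left_mono mult_right_mono)
  with A show "\<exists>A. \<forall>z. cmod (F z) \<le> A * exp ((\<tau> + \<epsilon>) * cmod z)" by (meson order_trans)
qed


section \<open>Boundedness of the Hausdorff operator\<close>

text \<open>A measure that is finite on compact sets and lives on \<open>{\<delta>..b}\<close> has finite total mass, which
  makes the exchange of integrals legitimate.\<close>

lemma finite_measure_completion_supported:
  assumes reg: "regular_borel_measure_on {0<..} \<mu>" and "0 < \<delta>"
    and supp: "supported_on \<mu> {\<delta>..b}"
  shows "finite_measure (completion \<mu>)"
proof
  have sets: "sets \<mu> = sets (restrict_space borel {0<..})"
    using reg by (simp add: regular_borel_measure_on_def)
  have sub: "{\<delta>..b} \<subseteq> {0<..}" using \<open>0 < \<delta>\<close> by auto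
  then have K: "{\<delta>..b} \<in> sets \<mu>"
    by (auto simp: sets sets_restrict_space image_iff intro!: bexI[of _ "{\<delta>..b}"])
  have "emeasure \<mu> (space \<mu>) = emeasure \<mu> {\<delta>..b}"
    using supp K emeasure_Diff_null_set[of "space \<mu> - {\<delta>..b}" \<mu> "space \<mu>"] sets.sets_into_space[OF K]
    by (simp add: supported_on_def double_diff)
  also have "\<dots> < \<infinity>"
    using reg sub compact_Icc[of \<delta> b] by (simp add: regular_borel_measure_on_def)
  finally show "emeasure (completion \<mu>) (space (completion \<mu>)) \<noteq> \<infinity>" by simp
qed

theorem corollary10:
  fixes \<mu> :: "real measure" and \<Phi> :: "real \<Rightarrow> complex" and \<delta> b :: real
  assumes "regular_borel_measure_on {0<..} \<mu>"
    and "\<Phi> \<in> borel_measurable (completion \<mu>)"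
    and "0 < \<delta>" and "\<delta> < b"
    and "supported_on \<mu> {\<delta>..b}"
  shows "hausdorff_bounded \<Phi> \<mu> (PW pi) (PW (max pi (pi / \<delta>))) \<longleftrightarrow> integrable (completion \<mu>) \<Phi>"
proof
  assume "hausdorff_bounded \<Phi> \<mu> (PW pi) (PW (max pi (pi / \<delta>)))"
  then have "\<forall>F\<in>PW pi. integrable (completion \<mu>) (\<lambda>u. \<Phi> u * F (0 / complex_of_real u))"
    unfolding hausdorff_bounded_def by blast
  from bspec[OF this sinc_pi_in_PW]
  have "integrable (completion \<mu>) (\<lambda>u. \<Phi> u * of_real pi)" by simp
  then have "integrable (completion \<mu>) (\<lambda>u. \<Phi> u * of_real pi * inverse (of_real pi))"
    by (rule integrable_mult_left)
  then show "integrable (completion \<mu>) \<Phi>" by (simp add: mult.assoc)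
next
  assume int: "integrable (completion \<mu>) \<Phi>"
  have sets: "sets \<mu> = sets (restrict_space borel {0<..})"
    using assms(1) by (simp add: regular_borel_measure_on_def)
  have "(\<lambda>u. u) \<in> borel_measurable \<mu>"
    by (subst measurable_cong_sets[OF sets refl]) (auto intro: measurable_restrict_space1)
  then have ident: "(\<lambda>u. u) \<in> borel_measurable (completion \<mu>)"
    by (rule measurable_completion)
  have "AE u in \<mu>. \<delta> \<le> u \<and> u \<le> b"
    by (rule AE_I'[of "space \<mu> - {\<delta>..b}"]) (use assms(5) in \<open>auto simp: supported_on_def\<close>)
  then have AE: "AE u in completion \<mu>. \<delta> \<le> u \<and> u \<le> b" by (rule AE_completion)
  interpret finite_measure "completion \<mu>"
    by (rule finite_measure_completion_supported[OF assms(1,3,5)])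
  interpret integrable_hausdorff_kernel "completion \<mu>" \<Phi> \<delta> b
    by unfold_locales (use ident int AE assms(3) in auto)
  have H: "hausdorff_op \<Phi> \<mu> F = transform F" for F
    by (simp add: fun_eq_iff hausdorff_op_def transform_def)
  have "0 \<le> b" using assms(3,4) by simp
  show "hausdorff_bounded \<Phi> \<mu> (PW pi) (PW (max pi (pi / \<delta>)))"
    unfolding hausdorff_bounded_def H
  proof (intro conjI ballI allI exI)
    fix F z assume "F \<in> PW pi"
    then have F: "F holomorphic_on UNIV" "exponential_type_le F pi"
        "integrable lborel (\<lambda>x::real. (cmod (F (of_real x)))\<^sup>2)"
      by (auto simp: PW_def)
    show "integrable (completion \<mu>) (\<lambda>u. \<Phi> u * F (z / complex_of_real u))"
      by (rule integrable_transform[OF F(1)])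
    show "PW_norm (transform F) \<le> mass * sqrt b * PW_norm F"
      by (rule PW_norm_transform_le[OF F(1,3) \<open>0 \<le> b\<close>])
    have "exponential_type_le (transform F) (max pi (pi / \<delta>))"
      using exponential_type_transform[OF F(1,2)] by (rule exponential_type_le_mono) auto
    then show "transform F \<in> PW (max pi (pi / \<delta>))"
      using holomorphic_transform[OF F(1)] PW_norm_transform_le(1)[OF F(1,3) \<open>0 \<le> b\<close>]
      by (simp add: PW_def)
  qed
qed

end
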